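(* Let $c\ge1$ be a constant such that $\epsilon=N^{-c}$ is an upper bound on the failure probability of SharedBit gossip when executed with shared randomness, i.e. $\Pr_{\hat r\gets\mathcal R}\left(Z(n,\ell,\mathcal G,A,\hat r)=1\right)\le\epsilon$ for all $n\in[2,N]$, $\ell\in[1,t_{BC}]$, $\mathcal G\in\mathbb G(n)$, $A\in\mathcal A(n)$. Then there exists a multiset $\mathcal R'$ of size $N^{\Theta(1)}$ containing values from $\mathcal R$, such that for every $n\in[2,N]$, $\ell\in[1,t_{BC}]$, $\mathcal G\in\mathbb G(n)$ and $A\in\mathcal A(n)$, $$\Pr_{\hat r\gets\mathcal R'}\left(Z(n,\ell,\mathcal G,A,\hat r)=1\right)<2\epsilon .$$
   Context: Let $N\ge2$ be an integer, $t_{SB}=c_0N^2$ for a constant integer $c_0\ge1$, $t_b=\lceil\log N\rceil+1$, $t_{BC}$ a positive integer with $t_{BC}=O(N^2\,\mathrm{polylog}(N))$, $t_{SSB}=t_{SB}+t_{BC}$, and $\mathcal R=\{0,1\}^{t_{SSB}\cdot N\cdot t_b}$. A string $\hat r\in\mathcal R$ is partitioned into $t_{SSB}$ groups labelled $1,2,\dots$, each consisting of $N$ bundles labelled $1,\dots,N$, each of $t_b$ bits. $\hat r\gets\mathcal R$ (resp. $\hat r\gets\mathcal R'$) means $\hat r$ is chosen uniformly at random from the set (resp. multiset, with multiplicity); the probabilities are over this choice and over the remaining randomness of the execution (the receivers' uniform choices among incoming proposals). "Size $N^{\Theta(1)}$" means the size is bounded above and below by $N$ to fixed positive constant powers independent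 of $N$. $\mathbb G(n)$ is the set of all $t_{SB}$-round dynamic graphs on $n$ nodes, i.e. sequences of $t_{SB}$ connected undirected graphs on the node set $[n]=\{1,\dots,n\}$. $\mathcal A(n)$ is the set of token assignments, i.e. functions $A:[n]\to2^{[n]}$, where $A(u)$ is the set of tokens node $u$ currently knows; tokens in the system are those in $\bigcup_uA(u)$. SharedBit run. Given $n,\ell,\mathcal G,A,\hat r$, run SharedBit for $t_{SB}$ rounds on $\mathcal G$ with initial token sets $A(u)$, where the $s$-th round ($1\le s\le t_{SB}$) uses group $g=\ell+s-1$ of $\hat r$, as follows. For each token $t$ known to $u$ let $t.\mathrm{bit}$ be the first bit of bundle $t$ of group $g$; node $u$ advertises to its current neighbors the sum modulo 2 of $t.\mathrm{bit}$ over the tokens it knows ($0$ if it knows none). A node $u$ advertising $1$ with at least one neighbor advertising $0$ chooses one such neighbor by a fixed rule from the remaining $\lceil\log N\rceil$ bits of bundle $u$ of group $g$ (intended as a uniform choice) and sends it a connection proposal. A node advertising $0$ that receives at least one proposal accepts one uniformly at random, and is connected with its sender for the round. When $u,v$ with different token sets connect, the smallest token in the symmetric difference of their token sets is passed to the node lacking it (i.e. the token transfer subroutine is assumed always to work correctly). $Z(n,\ell,\mathcal G,A,\hat r)$ is the random indicator variable equal to $0$ if this run solves gossip (after the $t_{SB}$ rounds every node knows every token in $\bigcup_uA(u)$) and equal to $1$ otherwise. *)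

theory Defs
  imports
    "HOL-Probability.Probability"
    "HOL-Library.Landau_Symbols"
    "Graph_Theory.Graph_Theory"
begin

text \<open>
  Logarithms are to base 2. Throughout, \<open>N\<close> is the known upper bound on the network size,
  \<open>c0\<close> the constant in the run length, and \<open>TBC\<close> the value \<open>t_BC\<close>.
\<close>

definition t_SB :: "nat \<Rightarrow> nat \<Rightarrow> nat" where
  "t_SB c0 N = c0 * N\<^sup>2"

definition t_b :: "nat \<Rightarrow> nat" where
  "t_b N = nat \<lceil>log 2 (real N)\<rceil> + 1"

definition t_SSB :: "nat \<Rightarrow> nat \<Rightarrow> nat \<Rightarrow> nat" where
  "t_SSB c0 TBC N = t_SB c0 N + TBC"

definition shared_strings :: "nat \<Rightarrow> nat \<Rightarrow> nat \<Rightarrow> bool list set" where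
  "shared_strings c0 TBC N = {r. length r = t_SSB c0 TBC N * N * t_b N}"

text \<open>Groups \<open>g\<close> and bundles \<open>i\<close> are both numbered from 1.\<close>

definition bundle_bits :: "nat \<Rightarrow> bool list \<Rightarrow> nat \<Rightarrow> nat \<Rightarrow> bool list" where
  "bundle_bits N r g i = take (t_b N) (drop (((g - 1) * N + (i - 1)) * t_b N) r)"

text \<open>
  Undirected simple graphs are symmetric loop-free digraphs. A \<open>t_SB\<close>-round dynamic graph is
  the list of its per-round graphs.
\<close>

definition dynamic_graphs :: "nat \<Rightarrow> nat \<Rightarrow> nat \<Rightarrow> nat pair_pre_digraph list set" where
  "dynamic_graphs c0 N n =
     {Gs. length Gs = t_SB c0 N \<and>
          (\<forall>G\<in>set Gs. pair_graph G \<and> pverts G = {1..n} \<and>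
             Digraph_Component.connected (with_proj G))}"

definition token_assignments :: "nat \<Rightarrow> (nat \<Rightarrow> nat set) set" where
  "token_assignments n = {1..n} \<rightarrow>\<^sub>E Pow {1..n}"

text \<open>
  The fixed rule by which an advertiser of 1 turns its random bits into a choice of neighbor:
  \<open>pick N u bs S\<close> is the node of \<open>S\<close> chosen by \<open>u\<close> from the bit string \<open>bs\<close>. Nothing is
  required of it except that it chooses an element of \<open>S\<close>.
\<close>

type_synonym pick_rule = "nat \<Rightarrow> nat \<Rightarrow> bool list \<Rightarrow> nat set \<Rightarrow> nat"

definition valid_pick_rule :: "pick_rule \<Rightarrow> bool" where
  "valid_pick_rule pick \<longleftrightarrow> (\<forall>N u bs S. finite S \<and> S \<noteq> {} \<longrightarrow> pick N u bs S \<in> S)"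

definition advert :: "nat \<Rightarrow> bool list \<Rightarrow> nat \<Rightarrow> (nat \<Rightarrow> nat set) \<Rightarrow> nat \<Rightarrow> nat" where
  "advert N r g A u = (\<Sum>t\<in>A u. of_bool (hd (bundle_bits N r g t))) mod 2"

definition zero_nbrs ::
  "nat \<Rightarrow> bool list \<Rightarrow> nat pair_pre_digraph \<Rightarrow> nat \<Rightarrow> (nat \<Rightarrow> nat set) \<Rightarrow> nat \<Rightarrow> nat set" where
  "zero_nbrs N r G g A u = {v. (u, v) \<in> parcs G \<and> advert N r g A v = 0}"

definition proposal ::
  "pick_rule \<Rightarrow> nat \<Rightarrow> bool list \<Rightarrow> nat pair_pre_digraph \<Rightarrow> nat \<Rightarrow> (nat \<Rightarrow> nat set) \<Rightarrow> nat \<Rightarrow> nat option"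
where
  "proposal pick N r G g A u =
     (if advert N r g A u = 1 \<and> zero_nbrs N r G g A u \<noteq> {}
      then Some (pick N u (tl (bundle_bits N r g u)) (zero_nbrs N r G g A u))
      else None)"

definition proposers ::
  "pick_rule \<Rightarrow> nat \<Rightarrow> bool list \<Rightarrow> nat pair_pre_digraph \<Rightarrow> nat \<Rightarrow> (nat \<Rightarrow> nat set) \<Rightarrow> nat \<Rightarrow> nat set"
where
  "proposers pick N r G g A v = {u \<in> pverts G. proposal pick N r G g A u = Some v}"

text \<open>
  Independent uniform choices of all nodes receiving a proposal: the sample maps each such node
  to the proposer it accepts, and every other node to \<open>None\<close>.
\<close>

definition acceptances ::
  "pick_rule \<Rightarrow> nat \<Rightarrow> bool list \<Rightarrow> nat pair_pre_digraph \<Rightarrow> nat \<Rightarrow> (nat \<Rightarrow> nat set) \<Rightarrow>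
   (nat \<Rightarrow> nat option) pmf"
where
  "acceptances pick N r G g A =
     Pi_pmf {v \<in> pverts G. proposers pick N r G g A v \<noteq> {}} None
       (\<lambda>v. map_pmf Some (pmf_of_set (proposers pick N r G g A v)))"

text \<open>
  The tokens of a node holding \<open>X\<close> after connecting to a node holding \<open>Y\<close>. The insertion changes
  nothing when the node already holds the smallest differing token, that is, when it is the one
  passing it on.
\<close>

definition transfer :: "nat set \<Rightarrow> nat set \<Rightarrow> nat set" where
  "transfer X Y = (if X = Y then X else insert (Min (sym_diff X Y)) X)"

text \<open>
  Under \<open>acc\<close>, nodes \<open>u\<close> and \<open>v\<close> are connected if one of them accepted the other. An accepting
  node advertises 0, a proposer advertises 1 and proposes to a single node, so the connections
  of a round form a matching and the order of the cases below is immaterial.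
\<close>

definition update ::
  "(nat \<Rightarrow> nat option) \<Rightarrow> (nat \<Rightarrow> nat set) \<Rightarrow> nat \<Rightarrow> nat set"
where
  "update acc A w =
     (case acc w of
        Some u \<Rightarrow> transfer (A w) (A u)
      | None \<Rightarrow>
          (if \<exists>v. acc v = Some w then transfer (A w) (A (THE v. acc v = Some w)) else A w))"

primrec shared_bit ::
  "pick_rule \<Rightarrow> nat \<Rightarrow> bool list \<Rightarrow> nat \<Rightarrow> nat pair_pre_digraph list \<Rightarrow> (nat \<Rightarrow> nat set) \<Rightarrow>
   (nat \<Rightarrow> nat set) pmf"
where
  "shared_bit pick N r g [] A = return_pmf A"
| "shared_bit pick N r g (G # Gs) A =
     bind_pmf (acceptances pick N r G g A)
       (\<lambda>acc. shared_bit pick N r (Suc g) Gs (update acc A))"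

definition solves_gossip :: "nat \<Rightarrow> (nat \<Rightarrow> nat set) \<Rightarrow> (nat \<Rightarrow> nat set) \<Rightarrow> bool" where
  "solves_gossip n A B \<longleftrightarrow> (\<forall>u\<in>{1..n}. (\<Union>v\<in>{1..n}. A v) \<subseteq> B u)"

text \<open>The distribution, for a fixed shared string, of the failure indicator.\<close>

definition Z_pmf ::
  "pick_rule \<Rightarrow> nat \<Rightarrow> nat \<Rightarrow> nat \<Rightarrow> nat pair_pre_digraph list \<Rightarrow> (nat \<Rightarrow> nat set) \<Rightarrow> bool list \<Rightarrow> nat pmf"
where
  "Z_pmf pick N n l Gs A r =
     map_pmf (\<lambda>B. if solves_gossip n A B then 0 else 1) (shared_bit pick N r l Gs A)"

definition failure_prob ::
  "pick_rule \<Rightarrow> nat \<Rightarrow> nat \<Rightarrow> nat \<Rightarrow> nat pair_pre_digraph list \<Rightarrow> (nat \<Rightarrow> nat set) \<Rightarrow> bool list pmf \<Rightarrow> real"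
where
  "failure_prob pick N n l Gs A D =
     measure_pmf.prob (bind_pmf D (Z_pmf pick N n l Gs A)) {1}"

end

theory Submission
  imports Defs
begin

text \<open>
  Instead of drawing \<open>R'\<close> at random and applying a Chernoff and a union bound, choose its elements
  one by one by the method of conditional expectations. For an instance \<open>i\<close> let \<open>f i r\<close> be the
  failure probability given the string \<open>r\<close>. Since \<open>2 powr f \<le> 1 + f\<close> on \<open>[0, 1]\<close>, the next string can
  always be chosen so that the potential \<open>\<Sum>i. 2 powr (\<Sum>j<M. f i (x j))\<close> grows by a factor of at
  most \<open>1 + \<epsilon>\<close>. After \<open>M\<close> steps every instance satisfies
  \<open>2 powr (\<Sum>j<M. f i (x j)) \<le> card I * exp (\<epsilon> * M)\<close>, which is less than \<open>2 powr (2 * \<epsilon> * M)\<close> as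
  soon as \<open>\<epsilon> * M\<close> exceeds a constant multiple of \<open>ln (card I)\<close>; and \<open>ln (card I) = O(N ^ 4)\<close>.
\<close>

section \<open>Derandomized sampling\<close>

text \<open>Convexity: on \<open>[0, 1]\<close> the function \<open>2 powr x\<close> lies below its
  chord, and the chord is \<open>1 + x\<close>.\<close>

lemma two_powr_le_one_plus:
  fixes x :: real
  assumes "0 \<le> x" "x \<le> 1"
  shows "2 powr x \<le> 1 + x"
proof -
  have "exp (x * ln 2) \<le> (1 - x) * exp 0 + x * exp (ln 2)"
    using convex_onD[OF exp_convex, of x 0 "ln 2"] assms by simp
  then show ?thesis by (simp add: powr_def)
qed

lemma exists_low_potential_sample:
  fixes f :: "'i \<Rightarrow> 'r \<Rightarrow> real" and \<epsilon> :: real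
  assumes R: "finite R" "R \<noteq> {}"
    and f01: "\<And>i r. i \<in> I \<Longrightarrow> r \<in> R \<Longrightarrow> 0 \<le> f i r \<and> f i r \<le> 1"
    and avg: "\<And>i. i \<in> I \<Longrightarrow> (\<Sum>r\<in>R. f i r) \<le> \<epsilon> * card R"
    and eps: "0 \<le> \<epsilon>"
  shows "\<exists>x :: nat \<Rightarrow> 'r. range x \<subseteq> R \<and>
           (\<Sum>i\<in>I. 2 powr (\<Sum>j<M. f i (x j))) \<le> card I * (1 + \<epsilon>) ^ M"
proof (induction M)
  case 0
  obtain r where "r \<in> R" using R by blast
  \<comment> \<open>Any constant sequence in \<open>R\<close> will do: the sums over
    \<open>j<0\<close> are empty and the potential is \<open>card I\<close>.\<close>
  then show ?case by (intro exI[of _ "\<lambda>_. r"]) auto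
next
  case (Suc M)
  then obtain x where x: "range x \<subseteq> R"
    and bound: "(\<Sum>i\<in>I. 2 powr (\<Sum>j<M. f i (x j))) \<le> card I * (1 + \<epsilon>) ^ M" by blast
  define w where "w i = 2 powr (\<Sum>j<M. f i (x j))" for i
  have w: "0 \<le> w i" for i by (simp add: w_def)
  define W where "W = (\<Sum>i\<in>I. w i)"
  \<comment> \<open>Total of the new potential over all candidates for the next string. After
    swapping the sums, \<open>avg\<close> applies to each instance separately.\<close>
  have "(\<Sum>r\<in>R. \<Sum>i\<in>I. w i * 2 powr f i r) = (\<Sum>i\<in>I. w i * (\<Sum>r\<in>R. 2 powr f i r))"
    by (subst sum.swap) (simp add: sum_distrib_left)
  also have "\<dots> \<le> (\<Sum>i\<in>I. w i * (card R * (1 + \<epsilon>)))"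
  proof (intro sum_mono mult_left_mono w)
    fix i assume i: "i \<in> I"
    have "(\<Sum>r\<in>R. 2 powr f i r) \<le> (\<Sum>r\<in>R. 1 + f i r)"
      using f01[OF i] by (intro sum_mono two_powr_le_one_plus) auto
    also have "\<dots> \<le> card R * (1 + \<epsilon>)"
      using avg[OF i] by (simp add: sum.distrib algebra_simps)
    finally show "(\<Sum>r\<in>R. 2 powr f i r) \<le> card R * (1 + \<epsilon>)" .
  qed
  also have "\<dots> = (\<Sum>r\<in>R. W * (1 + \<epsilon>))"
    by (simp add: W_def flip: sum_distrib_right)
  \<comment> \<open>Some candidate does no worse than the average: otherwise the sum over the
    nonempty \<open>R\<close> would be strictly larger.\<close>
  finally have "\<exists>r\<in>R. (\<Sum>i\<in>I. w i * 2 powr f i r) \<le> W * (1 + \<epsilon>)"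
    using sum_strict_mono[OF R, of "\<lambda>_. W * (1 + \<epsilon>)" "\<lambda>r. \<Sum>i\<in>I. w i * 2 powr f i r"]
    by (meson not_le)
  then obtain r where r: "r \<in> R" and le: "(\<Sum>i\<in>I. w i * 2 powr f i r) \<le> W * (1 + \<epsilon>)" by blast
  have "(\<Sum>i\<in>I. 2 powr (\<Sum>j<Suc M. f i ((x(M := r)) j))) = (\<Sum>i\<in>I. w i * 2 powr f i r)"
    by (intro sum.cong refl) (simp add: w_def powr_add)
  also have "\<dots> \<le> card I * (1 + \<epsilon>) ^ Suc M"
    using order_trans[OF le mult_right_mono[OF bound, of "1 + \<epsilon>", folded w_def, folded W_def]] eps
    by (simp add: mult_ac)
  finally show ?case
    using x r by (intro exI[of _ "x(M := r)"]) auto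
qed

text \<open>A single term of the potential is at most the whole potential, so the bound on the sum
  controls all instances at once, as a union bound would. \<open>D\<close> is a bound on the binary
  logarithm of their number.\<close>

lemma exists_uniform_sample:
  fixes f :: "'i \<Rightarrow> 'r \<Rightarrow> real" and \<epsilon> :: real
  assumes R: "finite R" "R \<noteq> {}"
    and I: "finite I"
    and f01: "\<And>i r. i \<in> I \<Longrightarrow> r \<in> R \<Longrightarrow> 0 \<le> f i r \<and> f i r \<le> 1"
    and avg: "\<And>i. i \<in> I \<Longrightarrow> (\<Sum>r\<in>R. f i r) \<le> \<epsilon> * card R"
    and eps: "0 < \<epsilon>"
    and card: "card I \<le> 2 ^ D" and D: "0 < D"
    and M: "3 * D \<le> \<epsilon> * M"
  shows "\<exists>x :: nat \<Rightarrow> 'r. range x \<subseteq> R \<and> (\<forall>i\<in>I. (\<Sum>j<M. f i (x j)) < 2 * \<epsilon> * M)"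
proof -
  obtain x :: "nat \<Rightarrow> 'r" where x: "range x \<subseteq> R"
    and bound: "(\<Sum>i\<in>I. 2 powr (\<Sum>j<M. f i (x j))) \<le> card I * (1 + \<epsilon>) ^ M"
    using exists_low_potential_sample[of R I f \<epsilon> M] R f01 avg eps by auto
  have "(\<Sum>j<M. f i (x j)) < 2 * \<epsilon> * M" if i: "i \<in> I" for i
  proof -
    have "2 powr (\<Sum>j<M. f i (x j)) \<le> (\<Sum>i\<in>I. 2 powr (\<Sum>j<M. f i (x j)))"
      using I i by (intro member_le_sum) auto
    also have "\<dots> \<le> card I * (1 + \<epsilon>) ^ M" by (rule bound)
    \<comment> \<open>Uses \<open>1 + \<epsilon> \<le> exp \<epsilon>\<close>.\<close>
    also have "\<dots> \<le> 2 ^ D * exp \<epsilon> ^ M"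
      using eps card by (intro mult_mono power_mono) (auto simp flip: of_nat_le_iff)
    also have "\<dots> = exp (D * ln 2 + \<epsilon> * M)"
      by (simp add: exp_add exp_of_nat_mult mult.commute[of \<epsilon>])
    \<comment> \<open>Origin of the 3 in \<open>M\<close>: with \<open>D \<le> E / 3\<close> it
      remains to see \<open>E < (5/3) * E * ln 2\<close>, that is \<open>ln 2 > 3/5\<close>, and
      \<open>ln 2 \<ge> 2/3\<close>.\<close>
    also have "\<dots> < exp (2 * \<epsilon> * M * ln 2)"
    proof -
      define E where "E = \<epsilon> * M"
      have "E > 0" using M D by (simp add: E_def)
      have "D * ln 2 \<le> (E / 3) * ln 2"
        using M by (intro mult_right_mono) (auto simp: E_def)
      then have "D * ln 2 \<le> E * ln 2 / 3" by simp
      moreover have "E * (2/3) \<le> E * ln 2"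
        using \<open>E > 0\<close> ln2_ge_two_thirds by (intro mult_left_mono) auto
      ultimately have "D * ln 2 + E < 2 * (E * ln 2)" using \<open>E > 0\<close> by linarith
      then show ?thesis by (simp add: E_def mult_ac)
    qed
    also have "\<dots> = 2 powr (2 * \<epsilon> * M)" by (simp add: powr_def)
    finally show ?thesis by simp
  qed
  with x show ?thesis by blast
qed

section \<open>Failure probabilities as averages over strings\<close>

text \<open>Conditioning on the string turns the failure probability, under \<open>\<R>\<close> as
  under \<open>R'\<close>, into a mean of the same function of \<open>r\<close>.\<close>

lemma failure_prob_eq:
  "failure_prob pick N n l Gs A D =
     measure_pmf.expectation D (\<lambda>r. pmf (Z_pmf pick N n l Gs A r) 1)"
  by (simp add: failure_prob_def measure_pmf_single pmf_bind)

lemma shared_strings_finite: "finite (shared_strings c0 T N)"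
  using finite_lists_length_eq[of "UNIV :: bool set"] by (simp add: shared_strings_def)

lemma shared_strings_nonempty: "shared_strings c0 T N \<noteq> {}"
  unfolding shared_strings_def using Ex_list_of_length by blast

section \<open>Counting the instances\<close>

lemma token_assignments_finite: "finite (token_assignments n)"
  by (auto simp: token_assignments_def intro: finite_PiE)

lemma card_token_assignments: "card (token_assignments n) = 2 ^ n\<^sup>2"
  by (simp add: token_assignments_def card_PiE card_Pow power2_eq_square flip: power_mult)

text \<open>A graph on \<open>{1..n}\<close> is determined by its arc set, one of the
  \<open>2 ^ n\<^sup>2\<close> subsets of \<open>{1..n} \<times> {1..n}\<close>; a dynamic graph is
  a list of \<open>t_SB c0 N\<close> of them.\<close>

lemma dynamic_graphs_finite: "finite (dynamic_graphs c0 N n)"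
  and card_dynamic_graphs: "card (dynamic_graphs c0 N n) \<le> 2 ^ (n\<^sup>2 * t_SB c0 N)"
proof -
  define S where "S = (\<lambda>E. \<lparr>pverts = {1..n}, parcs = E\<rparr>) ` Pow ({1..n} \<times> {1..n})"
  have S: "finite S" by (simp add: S_def)
  have "card S \<le> card (Pow ({1..n} \<times> {1..n}))"
    unfolding S_def by (rule card_image_le) simp
  then have cS: "card S \<le> 2 ^ n\<^sup>2"
    by (simp add: card_Pow power2_eq_square)
  have "G \<in> S" if "pair_graph G" "pverts G = {1..n}" for G
  proof -
    interpret pair_graph G by fact
    have "parcs G \<in> Pow ({1..n} \<times> {1..n})"
      using that(2) in_arcsD1 in_arcsD2 by auto
    moreover have "G = \<lparr>pverts = {1..n}, parcs = parcs G\<rparr>" using that(2) by (cases G) simp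
    ultimately show ?thesis unfolding S_def by blast
  qed
  then have sub: "dynamic_graphs c0 N n \<subseteq> {Gs. set Gs \<subseteq> S \<and> length Gs = t_SB c0 N}"
    by (auto simp: dynamic_graphs_def)
  note fin = finite_lists_length_eq[OF S, of "t_SB c0 N"]
  show "finite (dynamic_graphs c0 N n)" using finite_subset[OF sub fin] .
  have "card (dynamic_graphs c0 N n) \<le> card S ^ t_SB c0 N"
    using card_mono[OF fin sub] by (simp add: card_lists_length_eq[OF S])
  also have "\<dots> \<le> 2 ^ (n\<^sup>2 * t_SB c0 N)" 
    using power_mono[OF cS] by (simp add: power_mult)
  finally show "card (dynamic_graphs c0 N n) \<le> 2 ^ (n\<^sup>2 * t_SB c0 N)" .
qed

definition instances ::
  "nat \<Rightarrow> nat \<Rightarrow> nat \<Rightarrow> (nat \<times> nat \<times> nat pair_pre_digraph list \<times> (nat \<Rightarrow> nat set)) set"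
where
  "instances c0 T N =
     (SIGMA n:{2..N}. {1..T} \<times> dynamic_graphs c0 N n \<times> token_assignments n)"

lemma instances_finite: "finite (instances c0 T N)"
  by (auto simp: instances_def dynamic_graphs_finite token_assignments_finite)

lemma card_instances:
  assumes "T \<le> K * N ^ 3" "1 \<le> N"
  shows "card (instances c0 T N) \<le> 2 ^ ((K + c0 + 2) * N ^ 4)"
proof -
  have "card (instances c0 T N) =
      (\<Sum>n\<in>{2..N}. T * (card (dynamic_graphs c0 N n) * card (token_assignments n)))"
    by (simp add: instances_def card_SigmaI dynamic_graphs_finite token_assignments_finite
        card_cartesian_product)
  \<comment> \<open>Every factor, even the linear \<open>T\<close>, is replaced by a power of 2, so
    that only exponents need to be added.\<close>
  also have "\<dots> \<le> (\<Sum>n\<in>{2..N}. 2 ^ T * (2 ^ (N\<^sup>2 * t_SB c0 N) * 2 ^ N\<^sup>2))"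
  proof (intro sum_mono mult_mono)
    fix n assume "n \<in> {2..N}"
    then have n: "n\<^sup>2 \<le> N\<^sup>2" by simp
    show "card (dynamic_graphs c0 N n) \<le> 2 ^ (N\<^sup>2 * t_SB c0 N)"
      by (rule order_trans[OF card_dynamic_graphs]) (use n in simp)
    show "card (token_assignments n) \<le> 2 ^ N\<^sup>2"
      using n by (simp add: card_token_assignments)
  qed auto
  also have "\<dots> \<le> 2 ^ N * (2 ^ T * (2 ^ (N\<^sup>2 * t_SB c0 N) * 2 ^ N\<^sup>2))"
    using less_exp[of N] by (simp del: less_exp)
  also have "\<dots> = 2 ^ (N + T + N\<^sup>2 * t_SB c0 N + N\<^sup>2)"
    by (simp add: power_add)
  also have "\<dots> \<le> 2 ^ ((K + c0 + 2) * N ^ 4)"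
  proof (rule power_increasing)
    \<comment> \<open>Since \<open>t_SB c0 N = c0 * N\<^sup>2\<close>, the dynamic graphs contribute
      \<open>c0 * N ^ 4\<close>, the start groups at most \<open>K * N ^ 4\<close>, and
      \<open>N\<close> and \<open>N\<^sup>2\<close> account for the summand 2.\<close>
    have "N \<le> N ^ 4" "N\<^sup>2 \<le> N ^ 4" "N ^ 3 \<le> N ^ 4"
      using assms(2) power_increasing[of 1 4 N] by (auto intro!: power_increasing)
    moreover have "T \<le> K * N ^ 4"
      using assms(1) \<open>N ^ 3 \<le> N ^ 4\<close> by (meson mult_le_mono2 order_trans)
    ultimately show "N + T + N\<^sup>2 * t_SB c0 N + N\<^sup>2 \<le> (K + c0 + 2) * N ^ 4"
      by (simp add: t_SB_def algebra_simps flip: power_add)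
  qed simp
  finally show ?thesis .
qed

section \<open>Growth of \<open>t_BC\<close>\<close>

text \<open>One more factor \<open>N\<close> absorbs the polylogarithm. A cubic bound is harmless,
  as the dynamic graphs already cost \<open>N ^ 4\<close> in the exponent.\<close>

lemma quasi_quadratic_le_cubic:
  fixes T :: "nat \<Rightarrow> nat"
  assumes "(\<lambda>N. real (T N)) \<in> O(\<lambda>N. real N ^ 2 * log 2 (real N) ^ k)"
  shows "\<exists>K. \<forall>N\<ge>1. T N \<le> K * N ^ 3"
proof -
  have "(\<lambda>N. real N ^ 2 * log 2 (real N) ^ k) \<in> O(\<lambda>N. real N ^ 3)"
    by real_asymp
  from landau_o.big_trans[OF assms this] obtain C where
    "\<forall>\<^sub>F N in sequentially. norm (real (T N)) \<le> C * norm (real N ^ 3)"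
    by (elim landau_o.bigE)
  then obtain N0 where N0: "\<And>N. N \<ge> N0 \<Longrightarrow> real (T N) \<le> C * real N ^ 3"
    by (auto simp: eventually_sequentially)
  \<comment> \<open>The ceiling serves all \<open>N \<ge> N0\<close>; the sum covers the finitely
    many smaller \<open>N\<close>, making the bound valid from 1 on.\<close>
  define K where "K = nat \<lceil>C\<rceil> + (\<Sum>N<N0. T N)"
  have "T N \<le> K * N ^ 3" if "N \<ge> 1" for N
  proof (cases "N < N0")
    case True
    then have "T N \<le> (\<Sum>N<N0. T N)" by (intro member_le_sum) auto
    also have "\<dots> \<le> K * 1" by (simp add: K_def)
    also have "\<dots> \<le> K * N ^ 3" using that by (intro mult_le_mono2) simp
    finally show ?thesis .
  next
    case False
    then have "real (T N) \<le> C * real N ^ 3" using N0 by simp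
    also have "\<dots> \<le> real K * real N ^ 3"
    proof (rule mult_right_mono)
      have "C \<le> real (nat \<lceil>C\<rceil>)" by linarith
      then show "C \<le> real K" by (simp add: K_def del: of_nat_sum)
    qed simp
    finally have "real (T N) \<le> real (K * N ^ 3)" by simp
    then show ?thesis by (simp only: of_nat_le_iff)
  qed
  then show ?thesis by blast
qed

section \<open>Sample size and construction of \<open>R'\<close>\<close>

theorem lemma5p5:
  fixes c :: real and c0 :: nat and t_BC :: "nat \<Rightarrow> nat" and pick :: pick_rule
  assumes "c \<ge> 1"
    and "c0 \<ge> 1"
    and "\<forall>N\<ge>2. t_BC N > 0"
    and "\<exists>k::nat. (\<lambda>N. real (t_BC N)) \<in> O(\<lambda>N. real N ^ 2 * log 2 (real N) ^ k)"
    and "valid_pick_rule pick"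
  shows "\<exists>a>0::real. \<exists>b>0::real. \<forall>N\<ge>2::nat.
    (\<forall>n\<in>{2..N}. \<forall>l\<in>{1..t_BC N}. \<forall>Gs\<in>dynamic_graphs c0 N n. \<forall>A\<in>token_assignments n.
       failure_prob pick N n l Gs A (pmf_of_set (shared_strings c0 (t_BC N) N))
         \<le> real N powr (- c)) \<longrightarrow>
    (\<exists>R' :: bool list multiset.
       set_mset R' \<subseteq> shared_strings c0 (t_BC N) N \<and>
       real N powr a \<le> real (size R') \<and> real (size R') \<le> real N powr b \<and>
       (\<forall>n\<in>{2..N}. \<forall>l\<in>{1..t_BC N}. \<forall>Gs\<in>dynamic_graphs c0 N n. \<forall>A\<in>token_assignments n.
          failure_prob pick N n l Gs A (pmf_of_multiset R') < 2 * real N powr (- c)))"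
proof -
  obtain K where K: "\<And>N. N \<ge> 1 \<Longrightarrow> t_BC N \<le> K * N ^ 3"
    using assms(4) quasi_quadratic_le_cubic by metis
  \<comment> \<open>There are at most \<open>2 ^ (L * N ^ 4)\<close> instances. \<open>L\<close> and
    \<open>b\<close> are fixed before \<open>N\<close>, as the exponents must not depend on
    it.\<close>
  define L where "L = K + c0 + 2"
  define b where "b = 4 + c + 4 * real L"
  show ?thesis
  proof (rule exI[of _ 1], intro conjI, simp, rule exI[of _ b], intro conjI allI impI)
    show "b > 0" using assms(1) by (simp add: b_def)
  next
    fix N :: nat
    assume N: "2 \<le> N"
      and hyp: "\<forall>n\<in>{2..N}. \<forall>l\<in>{1..t_BC N}. \<forall>Gs\<in>dynamic_graphs c0 N n. \<forall>A\<in>token_assignments n.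
        failure_prob pick N n l Gs A (pmf_of_set (shared_strings c0 (t_BC N) N))
          \<le> real N powr (- c)"
    let ?R = "shared_strings c0 (t_BC N) N"
    let ?I = "instances c0 (t_BC N) N"
    define \<epsilon> where "\<epsilon> = real N powr (- c)"
    \<comment> \<open>The least \<open>M\<close> with
      \<open>\<epsilon> * M \<ge> 3 * L * N ^ 4\<close>; the factor \<open>N powr c\<close> cancels
      \<open>\<epsilon>\<close>.\<close>
    define M where "M = nat \<lceil>3 * real L * real N powr (4 + c)\<rceil>"
    define f where "f = (\<lambda>(n, l, Gs, A) r. pmf (Z_pmf pick N n l Gs A r) 1)"
    have eps: "\<epsilon> > 0" using N by (simp add: \<epsilon>_def)
    have big: "1 \<le> real N powr (4 + c)" using N assms(1) by (intro ge_one_powr_ge_zero) auto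
    have M_ge: "3 * real L * real N powr (4 + c) \<le> M" unfolding M_def by linarith
    have M_le: "M \<le> 3 * real L * real N powr (4 + c) + 1"
    proof -
      have "0 \<le> 3 * real L * real N powr (4 + c)" by simp
      then show ?thesis unfolding M_def by linarith
    qed
    have L: "real L \<ge> 2" by (simp add: L_def)
    have avg: "(\<Sum>r\<in>?R. f i r) \<le> \<epsilon> * card ?R" if i: "i \<in> ?I" for i
    proof -
      obtain n l Gs A where i_eq: "i = (n, l, Gs, A)" by (metis prod_cases4)
      have "failure_prob pick N n l Gs A (pmf_of_set ?R) \<le> \<epsilon>"
        using hyp i by (auto simp: i_eq instances_def \<epsilon>_def)
      moreover have "card ?R > 0"
        using shared_strings_finite shared_strings_nonempty by (simp add: card_gt_0_iff)
      ultimately show ?thesis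
        by (simp add: failure_prob_eq i_eq f_def field_simps
            integral_pmf_of_set[OF shared_strings_nonempty shared_strings_finite])
    qed
    have "\<exists>x :: nat \<Rightarrow> _. range x \<subseteq> ?R \<and> (\<forall>i\<in>?I. (\<Sum>j<M. f i (x j)) < 2 * \<epsilon> * M)"
    proof (rule exists_uniform_sample)
      show "card ?I \<le> 2 ^ (L * N ^ 4)"
        unfolding L_def using card_instances K N by simp
      show "0 < L * N ^ 4" using N by (simp add: L_def)
      have "3 * real (L * N ^ 4) = \<epsilon> * (3 * real L * real N powr (4 + c))"
        using N by (simp add: \<epsilon>_def powr_add powr_minus field_simps)
      also have "\<dots> \<le> \<epsilon> * M" using M_ge eps by simp
      finally show "3 * real (L * N ^ 4) \<le> \<epsilon> * M" .
    qed (use avg eps in \<open>auto simp: shared_strings_finite shared_strings_nonempty instances_finite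
          f_def pmf_le_1 split: prod.splits\<close>)
    then obtain x :: "nat \<Rightarrow> bool list" where x: "range x \<subseteq> ?R"
      and sums: "\<And>i. i \<in> ?I \<Longrightarrow> (\<Sum>j<M. f i (x j)) < 2 * \<epsilon> * M" by blast
    \<comment> \<open>A multiset, because \<open>x\<close> may repeat strings and each index must
      keep its weight \<open>1 / M\<close>.\<close>
    define R' where "R' = image_mset x (mset_set {..<M})"
    have size: "size R' = M" by (simp add: R'_def)
    have M_lower: "real N powr 1 \<le> M"
    proof -
      have "real N powr 1 \<le> 1 * real N powr (4 + c)"
        using N assms(1) by (simp only: mult_1) (intro powr_mono, auto)
      also have "\<dots> \<le> 3 * real L * real N powr (4 + c)"
        using L by (intro mult_right_mono) auto
      finally show ?thesis using M_ge by linarith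
    qed
    then have M_pos: "M > 0" using N by (cases M) auto
    have M_upper: "M \<le> real N powr b"
    proof -
      \<comment> \<open>The extra 1 from rounding up is absorbed by a fourth multiple of
        \<open>L * N powr (4 + c)\<close>.\<close>
      have "M \<le> 3 * real L * real N powr (4 + c) + L * real N powr (4 + c)"
        using M_le mult_mono[of 1 "real L" 1 "real N powr (4 + c)"] L big by simp
      also have "\<dots> = real (4 * L) * real N powr (4 + c)" by (simp add: algebra_simps)
      also have "\<dots> \<le> real N powr (4 * L) * real N powr (4 + c)"
      proof (rule mult_right_mono)
        \<comment> \<open>As \<open>N \<ge> 2\<close>, the constant factor is itself a power of
          \<open>N\<close> with fixed exponent, hence the summand \<open>4 * L\<close> in
          \<open>b\<close>.\<close>
        have "4 * L \<le> N ^ (4 * L)"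
          using less_exp[of "4 * L"] power_mono[OF N, of "4 * L"] by linarith
        then have "real (4 * L) \<le> real (N ^ (4 * L))" by (simp only: of_nat_le_iff)
        then show "real (4 * L) \<le> real N powr real (4 * L)"
          using N by (subst powr_realpow) auto
      qed simp
      also have "\<dots> = real N powr b" by (simp add: b_def powr_add)
      finally show ?thesis .
    qed
    have fail: "failure_prob pick N n l Gs A (pmf_of_multiset R') < 2 * \<epsilon>"
      if "n \<in> {2..N}" "l \<in> {1..t_BC N}" "Gs \<in> dynamic_graphs c0 N n" "A \<in> token_assignments n"
      for n l Gs A
    proof -
      have ne: "{..<M} \<noteq> {}" using M_pos by auto
      \<comment> \<open>Drawing from \<open>R'\<close> is drawing a uniform index below
        \<open>M\<close> and applying \<open>x\<close>, so the failure probability is the mean of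
        the bounded sum.\<close>
      have "pmf_of_multiset R' = map_pmf x (pmf_of_set {..<M})"
        unfolding R'_def using ne by (simp add: map_pmf_of_set)
      then have "failure_prob pick N n l Gs A (pmf_of_multiset R')
          = (\<Sum>j<M. f (n, l, Gs, A) (x j)) / M"
        using integral_pmf_of_set[OF ne] by (simp add: failure_prob_eq f_def)
      also have "\<dots> < 2 * \<epsilon>"
        using sums[of "(n, l, Gs, A)"] that M_pos by (simp add: instances_def field_simps)
      finally show ?thesis .
    qed
    show "\<exists>R'. set_mset R' \<subseteq> ?R \<and> real N powr 1 \<le> real (size R') \<and> real (size R') \<le> real N powr b \<and>
       (\<forall>n\<in>{2..N}. \<forall>l\<in>{1..t_BC N}. \<forall>Gs\<in>dynamic_graphs c0 N n. \<forall>A\<in>token_assignments n.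
          failure_prob pick N n l Gs A (pmf_of_multiset R') < 2 * real N powr (- c))"
      using x fail M_lower M_upper
      by (intro exI[of _ R']) (auto simp: size R'_def \<epsilon>_def)
  qed
qed

end
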